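(* Let $A$ be a matrix with $m$ rows and $k$ columns whose entries are pairwise distinct. Then $\textsc{FindHorizontalPivot}(A)$ finds (returns) a horizontal pivot of $A$ with probability at least $1-e^{-\Omega(m^{1/20})}$.
   Context: An entry $A_{ij}$ is a horizontal pivot of $A$ if every row of $A$ contains an entry at least as large as $A_{ij}$, and at least a quarter of the entries in row $i$ are smaller than $A_{ij}$. $\textsc{FindHorizontalPivot}(A)$: let $R$ be the set of rows of $A$ and $m=|R|$. Phase 1: set $t\gets\infty$; while $|R|>\lfloor m^{19/20}\rfloor$: for each row $i$ of $R$, let $q_i$ be the entry of row $i$ at a position drawn uniformly at random from $\{1,\dots,k\}$; let $q$ be the $\lceil\frac34|R|\rceil$-th smallest of the $q_i$; set $t\gets\min\{t,q\}$; delete from $R$ all rows $i$ with $q_i>t$. Phase 2: for each remaining row $r$ of $R$, draw $\lfloor m^{1/20}\rfloor$ entries of $r$ at positions drawn uniformly at random from $\{1,\dots,k\}$, and let $q'_r$ be the $\lfloor\frac25\lfloor m^{1/20}\rfloor\rfloor$-th smallest of them. Let $p=\min_r q'_r$. If $p>t$ or $p$ is not larger than $\lfloor k/4\rfloor$ entries in its row of $A$, return \textsc{Failed}; otherwise return $p$. All random draws are independent. Asymptotic notation is as $m\to\infty$.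
   Formalization: The claim is false for k = 1, 2, 5 columns; it is proved as stated for all other k ≥ 1, and for every k ≥ 1 with "at least a quarter of the entries in row i" replaced by "at least ⌊k/4⌋ entries", the rounding that the algorithm itself tests. *)

theory Defs
  imports
    "HOL-Probability.Probability"
    "HOL-Library.Extended"
    "Jordan_Normal_Form.Matrix"
begin

text \<open>Rows and columns are indexed from 0, as usual for \<^typ>\<open>'a mat\<close>. Only the order of the
  entries matters, so they are taken from an arbitrary linear order.\<close>

definition distinct_entries :: "'a mat \<Rightarrow> bool" where
  "distinct_entries A \<longleftrightarrow> inj_on (\<lambda>ij. A $$ ij) ({..<dim_row A} \<times> {..<dim_col A})"

definition num_smaller :: "'a::linorder mat \<Rightarrow> nat \<Rightarrow> 'a \<Rightarrow> nat" where
  "num_smaller A i x = card {j. j < dim_col A \<and> A $$ (i, j) < x}"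

definition every_row_reaches :: "'a::linorder mat \<Rightarrow> 'a \<Rightarrow> bool" where
  "every_row_reaches A x \<longleftrightarrow> (\<forall>r<dim_row A. \<exists>j<dim_col A. x \<le> A $$ (r, j))"

definition horizontal_pivot :: "'a::linorder mat \<Rightarrow> nat \<Rightarrow> nat \<Rightarrow> bool" where
  "horizontal_pivot A i j \<longleftrightarrow>
     i < dim_row A \<and> j < dim_col A \<and>
     every_row_reaches A (A $$ (i, j)) \<and>
     real (dim_col A) / 4 \<le> real (num_smaller A i (A $$ (i, j)))"

text \<open>The algorithm below tests its candidate against \<open>\<lfloor>k/4\<rfloor>\<close>, not \<open>k/4\<close>. The following variant
  rounds "a quarter of the entries" in the same way. The difference matters for
  \<open>k \<in> {1, 2, 5}\<close>: if \<open>k = 1\<close> no entry at all is a \<^const>\<open>horizontal_pivot\<close>; if \<open>k = 2\<close>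
  (\<open>k = 5\<close>) and the smallest entry (two smallest entries) of each row are below all the other
  entries of the matrix, then the candidate is, with probability close to 1, one of these small
  entries, hence not a \<^const>\<open>horizontal_pivot\<close>, and yet it passes the test. In all other
  cases \<open>\<lceil>k/4\<rceil> / k \<le> 1/3 < 2/5\<close>.\<close>

definition horizontal_pivot_floor :: "'a::linorder mat \<Rightarrow> nat \<Rightarrow> nat \<Rightarrow> bool" where
  "horizontal_pivot_floor A i j \<longleftrightarrow>
     i < dim_row A \<and> j < dim_col A \<and>
     every_row_reaches A (A $$ (i, j)) \<and>
     \<lfloor>real (dim_col A) / 4\<rfloor> \<le> int (num_smaller A i (A $$ (i, j)))"

text \<open>Counted from 1 and with multiplicity; meant for \<open>1 \<le> n \<le> length xs\<close>.\<close>

definition nth_smallest :: "nat \<Rightarrow> 'a::linorder list \<Rightarrow> 'a" where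
  "nth_smallest n xs = sort xs ! (n - 1)"

definition random_position :: "'a mat \<Rightarrow> nat pmf" where
  "random_position A = pmf_of_set {..<dim_col A}"

text \<open>The loop need not terminate for \<open>m \<in> {2, 3}\<close>, where it may delete no row. Divergence is
  missing probability mass of the \<^typ>\<open>'a spmf\<close>.\<close>

partial_function (spmf) phase1 ::
  "'a::linorder mat \<Rightarrow> nat set \<Rightarrow> 'a extended \<Rightarrow> (nat set \<times> 'a extended) spmf" where
  "phase1 A R t =
     (if card R > nat \<lfloor>real (dim_row A) powr (19/20)\<rfloor> then
        bind_spmf (spmf_of_pmf (Pi_pmf R 0 (\<lambda>_. random_position A))) (\<lambda>J.
          let qs = (\<lambda>i. A $$ (i, J i));
              q = nth_smallest (nat \<lceil>3/4 * real (card R)\<rceil>) (map qs (sorted_list_of_set R));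
              t' = min t (Fin q)
          in phase1 A (R - {i \<in> R. Fin (qs i) > t'}) t')
      else return_spmf (R, t))"

datatype 'a outcome = Failed | Returned 'a

text \<open>If no row is left, then \<open>p = min \<emptyset> = \<infinity>\<close> and the algorithm fails.\<close>

definition phase2 ::
  "'a::linorder mat \<Rightarrow> nat set \<Rightarrow> 'a extended \<Rightarrow> 'a outcome pmf" where
  "phase2 A R t =
     (let s = nat \<lfloor>real (dim_row A) powr (1/20)\<rfloor> in
      map_pmf (\<lambda>J.
        let q' = (\<lambda>r. nth_smallest (nat \<lfloor>2/5 * real s\<rfloor>) (map (\<lambda>l. A $$ (r, J r l)) [0..<s]));
            p = Min (q' ` R)
        in if R = {} \<or> Fin p > t \<or>
              (\<exists>r<dim_row A. \<exists>j<dim_col A. A $$ (r, j) = p \<and>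
                 int (num_smaller A r p) < \<lfloor>real (dim_col A) / 4\<rfloor>)
           then Failed else Returned p)
        (Pi_pmf R (\<lambda>_. 0) (\<lambda>_. Pi_pmf {..<s} 0 (\<lambda>_. random_position A))))"

definition find_horizontal_pivot :: "'a::linorder mat \<Rightarrow> 'a outcome spmf" where
  "find_horizontal_pivot A =
     bind_spmf (phase1 A {..<dim_row A} Pinf) (\<lambda>(R, t). spmf_of_pmf (phase2 A R t))"

definition prob_returns ::
  "('a::linorder mat \<Rightarrow> nat \<Rightarrow> nat \<Rightarrow> bool) \<Rightarrow> 'a mat \<Rightarrow> real" where
  "prob_returns P A =
     measure (measure_spmf (find_horizontal_pivot A)) {Returned (A $$ (i, j)) | i j. P A i j}"

end

theory Submission
  imports Defs "HOL-Real_Asymp.Real_Asymp"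
begin

text \<open>Every returned value is a pivot up to rounding: a deleted row has an entry above the final
  \<open>t\<close>, a remaining row \<open>r\<close> has the entry \<open>q'\<^sub>r \<ge> p\<close>, and the number of smaller entries is tested.
  So only \<^const>\<open>Failed\<close> and the rank of \<open>p\<close> in its row have to be controlled. The rank is
  controlled by Hoeffding's inequality, as a \<open>2/5\<close>-quantile of \<open>\<lfloor>m\<^bsup>1/20\<^esup>\<rfloor>\<close> samples exceeds a
  \<open>1/3\<close>-quantile of the row.

  For \<open>p \<le> t\<close> it suffices that some remaining row has at least half of its entries below \<open>t\<close>. Let
  \<open>F\<^sub>i(t)\<close> be the fraction of entries of row \<open>i\<close> that are at most \<open>t\<close>. The average of \<open>F\<^sub>i(t)\<close> over
  \<open>R\<close> stays close to \<open>3/4\<close>: if a round keeps about \<open>\<Sum>F\<^sub>i(t) \<approx> 3/4 |R|\<close> rows, then the sum over the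
  kept rows is about \<open>\<Sum>F\<^sub>i(t)\<^sup>2\<close>, which by convexity is at least \<open>(3/4)\<^sup>2 |R|\<close>. The error of the
  average at most doubles in each round, up to a fluctuation \<open>\<gamma> = m\<^bsup>-3/10\<^esup>\<close>, while \<open>|R|\<close> shrinks by
  \<open>3/4\<close>; hence it is bounded by \<open>12 \<gamma> (m/|R|)\<^sup>3\<close>, because \<open>(4/3)\<^sup>3 > 2\<close>. As \<open>|R| \<ge> m\<^bsup>19/20\<^esup>/2\<close> this tends
  to 0.\<close>

section \<open>Order statistics of lists\<close>

lemma nth_smallest_in_set:
  assumes "1 \<le> n" "n \<le> length xs"
  shows "nth_smallest n xs \<in> set xs"
proof -
  have "sort xs ! (n - 1) \<in> set (sort xs)"
    using assms by (intro nth_mem) auto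
  then show ?thesis by (simp add: nth_smallest_def)
qed

lemma length_filter_sort: "length (filter P (sort xs)) = length (filter P xs)"
  by (metis mset_filter mset_sort size_mset)

text \<open>Turns a bound on an order statistic into a bound on a count, to which Hoeffding's
  inequality applies.\<close>

lemma nth_smallest_le_iff:
  assumes "1 \<le> n" "n \<le> length xs"
  shows "nth_smallest n xs \<le> y \<longleftrightarrow> n \<le> length (filter (\<lambda>x. x \<le> y) xs)"
proof -
  define ys where "ys = sort xs"
  have len: "length ys = length xs" and srt: "sorted ys"
    by (simp_all add: ys_def)
  have card: "length (filter (\<lambda>x. x \<le> y) xs) = card {i. i < length ys \<and> ys ! i \<le> y}"
    using length_filter_conv_card[of "\<lambda>x. x \<le> y" ys] by (simp add: ys_def length_filter_sort)
  show ?thesis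
  proof
    assume "nth_smallest n xs \<le> y"
    then have le: "ys ! (n - 1) \<le> y" by (simp add: nth_smallest_def ys_def)
    have "ys ! i \<le> y" if "i < n" for i
      using sorted_nth_mono[OF srt, of i "n - 1"] le that assms len by (force intro: order_trans)
    then have "{..<n} \<subseteq> {i. i < length ys \<and> ys ! i \<le> y}"
      using assms len by auto
    from card_mono[OF _ this] show "n \<le> length (filter (\<lambda>x. x \<le> y) xs)"
      using card by simp
  next
    assume n: "n \<le> length (filter (\<lambda>x. x \<le> y) xs)"
    show "nth_smallest n xs \<le> y"
    proof (rule ccontr)
      assume "\<not> nth_smallest n xs \<le> y"
      then have gt: "y < ys ! (n - 1)" by (simp add: nth_smallest_def ys_def)
      have "i < n - 1" if "i < length ys" "ys ! i \<le> y" for i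
        using sorted_nth_mono[OF srt, of "n - 1" i] gt that by (meson leD le_less_trans not_le_imp_less)
      then have "{i. i < length ys \<and> ys ! i \<le> y} \<subseteq> {..<n - 1}" by auto
      from card_mono[OF _ this] show False
        using card n assms by simp
    qed
  qed
qed

text \<open>Only strictly smaller elements are counted, as ties may extend past position
  \<open>n\<close>; distinct entries settle the ties later.\<close>

lemma length_filter_less_nth_smallest:
  assumes "1 \<le> n" "n \<le> length xs"
  shows "length (filter (\<lambda>x. x < nth_smallest n xs) xs) < n"
proof -
  define ys where "ys = sort xs"
  have len: "length ys = length xs" and srt: "sorted ys"
    by (simp_all add: ys_def)
  have "length (filter (\<lambda>x. x < nth_smallest n xs) xs)
      = card {i. i < length ys \<and> ys ! i < ys ! (n - 1)}"
    using length_filter_conv_card[of "\<lambda>x. x < nth_smallest n xs" ys]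
    by (simp add: ys_def length_filter_sort) (simp add: nth_smallest_def)
  also have "\<dots> \<le> card {..<n - 1}"
  proof (intro card_mono subsetI)
    fix i assume "i \<in> {i. i < length ys \<and> ys ! i < ys ! (n - 1)}"
    then show "i \<in> {..<n - 1}"
      using sorted_nth_mono[OF srt, of "n - 1" i] by (force simp: not_less)
  qed auto
  finally show ?thesis using assms by simp
qed

lemma length_filter_map_sorted_list_of_set:
  fixes R :: "nat set"
  assumes "finite R"
  shows "length (filter P (map f (sorted_list_of_set R))) = card {i \<in> R. P (f i)}"
proof -
  have "length (filter P (map f (sorted_list_of_set R)))
      = length (filter (P \<circ> f) (sorted_list_of_set R))"
    by (simp add: filter_map)
  also have "\<dots> = card (set (filter (P \<circ> f) (sorted_list_of_set R)))"
    by (intro distinct_card[symmetric]) auto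
  finally show ?thesis using assms by simp
qed

section \<open>Concentration in product spaces and chaining of random stages\<close>

text \<open>The coordinates of \<open>Pi_pmf\<close> are independent. Since \<open>X\<close> depends
  on \<open>i\<close>, rows can carry individual weights.\<close>

lemma
  fixes X :: "'i \<Rightarrow> 'b \<Rightarrow> real"
  assumes fin: "finite I" and ne: "I \<noteq> {}"
    and bnd: "\<And>i x. i \<in> I \<Longrightarrow> X i x \<in> {0..1}" and \<epsilon>: "\<epsilon> \<ge> 0"
  shows Hoeffding_Pi_pmf_ge:
    "measure_pmf.prob (Pi_pmf I d p)
       {f. (\<Sum>i\<in>I. X i (f i)) \<ge> (\<Sum>i\<in>I. measure_pmf.expectation (p i) (X i)) + \<epsilon>}
     \<le> exp (- 2 * \<epsilon>\<^sup>2 / card I)"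
    and Hoeffding_Pi_pmf_le:
    "measure_pmf.prob (Pi_pmf I d p)
       {f. (\<Sum>i\<in>I. X i (f i)) \<le> (\<Sum>i\<in>I. measure_pmf.expectation (p i) (X i)) - \<epsilon>}
     \<le> exp (- 2 * \<epsilon>\<^sup>2 / card I)"
proof -
  let ?M = "measure_pmf (Pi_pmf I d p)"
  have E: "measure_pmf.expectation (Pi_pmf I d p) (\<lambda>f. X i (f i))
      = measure_pmf.expectation (p i) (X i)" if "i \<in> I" for i
  proof -
    have "measure_pmf.expectation (Pi_pmf I d p) (\<lambda>f. X i (f i))
        = measure_pmf.expectation (map_pmf (\<lambda>f. f i) (Pi_pmf I d p)) (X i)"
      by simp
    also have "map_pmf (\<lambda>f. f i) (Pi_pmf I d p) = p i"
      using that fin by (simp add: Pi_pmf_component)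
    finally show ?thesis .
  qed
  interpret Hoeffding_ineq ?M I "\<lambda>i f. X i (f i)" "\<lambda>_. 0" "\<lambda>_. 1"
    "\<Sum>i\<in>I. measure_pmf.expectation (p i) (X i)"
  proof unfold_locales
    show "prob_space.indep_vars ?M (\<lambda>_. borel) (\<lambda>i f. X i (f i)) I"
      by (intro prob_space.indep_vars_compose2[OF _ indep_vars_Pi_pmf])
         (auto simp: measure_pmf.prob_space_axioms fin)
  next
    show "(\<Sum>i\<in>I. measure_pmf.expectation (p i) (X i)) \<equiv>
      (\<Sum>i\<in>I. measure_pmf.expectation (Pi_pmf I d p) (\<lambda>f. X i (f i)))"
      using E by (intro eq_reflection sum.cong) auto
  qed (use fin bnd in auto)
  have "card I > 0" using fin ne by (simp add: card_gt_0_iff)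
  then show "measure_pmf.prob (Pi_pmf I d p)
       {f. (\<Sum>i\<in>I. X i (f i)) \<ge> (\<Sum>i\<in>I. measure_pmf.expectation (p i) (X i)) + \<epsilon>}
     \<le> exp (- 2 * \<epsilon>\<^sup>2 / card I)"
    and "measure_pmf.prob (Pi_pmf I d p)
       {f. (\<Sum>i\<in>I. X i (f i)) \<le> (\<Sum>i\<in>I. measure_pmf.expectation (p i) (X i)) - \<epsilon>}
     \<le> exp (- 2 * \<epsilon>\<^sup>2 / card I)"
    using Hoeffding_ineq_ge[OF \<epsilon>] Hoeffding_ineq_le[OF \<epsilon>] by auto
qed

text \<open>Success probabilities of consecutive stages multiply. Diverging runs carry no mass, so a
  lower bound obtained this way also accounts for termination.\<close>

lemma measure_bind_spmf_ge:
  assumes "0 \<le> b" and "a \<le> measure (measure_spmf p) G"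
    and "\<And>x. x \<in> set_spmf p \<Longrightarrow> x \<in> G \<Longrightarrow> b \<le> measure (measure_spmf (f x)) S"
  shows "a * b \<le> measure (measure_spmf (bind_spmf p f)) S"
proof -
  have "a * b \<le> measure (measure_spmf p) G * b"
    using assms by (intro mult_right_mono) auto
  also have "\<dots> = (\<integral>x. indicator G x * b \<partial>measure_spmf p)"
    by simp
  also have "\<dots> \<le> (\<integral>x. measure (measure_spmf (f x)) S \<partial>measure_spmf p)"
  proof (rule integral_mono_AE)
    show "integrable (measure_spmf p) (\<lambda>x. indicator G x * b)"
      by (rule measure_spmf.integrable_const_bound[where B = "b"])
         (use assms in \<open>auto simp: indicator_def\<close>)
    show "integrable (measure_spmf p) (\<lambda>x. measure (measure_spmf (f x)) S)"
      by (rule measure_spmf.integrable_const_bound[where B = "1"])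
         (auto simp: measure_spmf.subprob_measure_le_1)
    show "AE x in measure_spmf p. indicator G x * b \<le> measure (measure_spmf (f x)) S"
      using assms by (auto simp: indicator_def)
  qed
  also have "\<dots> = measure (measure_spmf (bind_spmf p f)) S"
    by (simp add: measure_spmf_bind o_def
        measure_spmf.measure_bind[where N = "count_space UNIV"] space_subprob_algebra)
  finally show ?thesis .
qed

section \<open>One round of phase 1\<close>

text \<open>This is \<open>F\<^sub>i(t)\<close> of the overview. The threshold lives in
  \<open>'a extended\<close> because phase 1 starts at \<open>Pinf\<close>.\<close>

definition row_cdf :: "'a::linorder mat \<Rightarrow> nat \<Rightarrow> 'a extended \<Rightarrow> real" where
  "row_cdf A i t = measure_pmf.prob (random_position A) {j. Fin (A $$ (i, j)) \<le> t}"

lemma row_cdf_nonneg [simp]: "0 \<le> row_cdf A i t"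
  and row_cdf_le_1 [simp]: "row_cdf A i t \<le> 1"
  by (simp_all add: row_cdf_def)

lemma row_cdf_mono: "s \<le> t \<Longrightarrow> row_cdf A i s \<le> row_cdf A i t"
  unfolding row_cdf_def by (intro measure_pmf.finite_measure_mono) auto

lemma row_cdf_Pinf [simp]: "row_cdf A i Pinf = 1"
  by (simp add: row_cdf_def)

lemma set_random_position: "dim_col A > 0 \<Longrightarrow> set_pmf (random_position A) = {..<dim_col A}"
  unfolding random_position_def by (subst set_pmf_of_set) auto

definition round_threshold ::
  "'a::linorder mat \<Rightarrow> nat set \<Rightarrow> 'a extended \<Rightarrow> (nat \<Rightarrow> nat) \<Rightarrow> 'a extended" where
  "round_threshold A R t J = min t (Fin (nth_smallest (nat \<lceil>3/4 * real (card R)\<rceil>)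
     (map (\<lambda>i. A $$ (i, J i)) (sorted_list_of_set R))))"

definition survivors ::
  "'a::linorder mat \<Rightarrow> nat set \<Rightarrow> 'a extended \<Rightarrow> (nat \<Rightarrow> nat) \<Rightarrow> nat set" where
  "survivors A R t J = {i \<in> R. Fin (A $$ (i, J i)) \<le> round_threshold A R t J}"

lemma phase1_unfold:
  "phase1 A R t =
     (if card R > nat \<lfloor>real (dim_row A) powr (19/20)\<rfloor> then
        bind_spmf (spmf_of_pmf (Pi_pmf R 0 (\<lambda>_. random_position A))) (\<lambda>J.
          phase1 A (survivors A R t J) (round_threshold A R t J))
      else return_spmf (R, t))"
proof -
  have "R - {i \<in> R. Fin (A $$ (i, J i)) > round_threshold A R t J} = survivors A R t J" for J
    by (auto simp: survivors_def)
  then show ?thesis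
    by (subst phase1.simps) (simp only: Let_def flip: round_threshold_def)
qed

lemma round_threshold_le: "round_threshold A R t J \<le> t"
  by (simp add: round_threshold_def)

lemma quantile_index_bounds:
  assumes "finite R" "R \<noteq> {}"
  shows "1 \<le> nat \<lceil>3/4 * real (card R)\<rceil>" "nat \<lceil>3/4 * real (card R)\<rceil> \<le> card R"
proof -
  have "card R > 0" using assms by (simp add: card_gt_0_iff)
  then show "1 \<le> nat \<lceil>3/4 * real (card R)\<rceil>" "nat \<lceil>3/4 * real (card R)\<rceil> \<le> card R"
    by linarith+
qed

text \<open>Fewer than \<open>N\<close> samples lie strictly below the quantile \<open>q\<close>,
  and distinct entries let at most one row sample \<open>q\<close> itself; taking the minimum with
  \<open>t\<close> can only delete more rows.\<close>

lemma card_survivors_le: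
  assumes dist: "distinct_entries A" and R: "R \<subseteq> {..<dim_row A}" "R \<noteq> {}"
    and J: "\<And>i. i \<in> R \<Longrightarrow> J i < dim_col A"
  shows "real (card (survivors A R t J)) \<le> 3/4 * real (card R) + 1"
proof -
  have fin: "finite R" using R finite_subset by blast
  define N where "N = nat \<lceil>3/4 * real (card R)\<rceil>"
  define xs where "xs = map (\<lambda>i. A $$ (i, J i)) (sorted_list_of_set R)"
  define q where "q = nth_smallest N xs"
  have N: "1 \<le> N" "N \<le> length xs"
    using quantile_index_bounds[OF fin R(2)] by (simp_all add: N_def xs_def)
  have less: "card {i \<in> R. A $$ (i, J i) < q} < N"
    using length_filter_less_nth_smallest[OF N]
    unfolding q_def[symmetric] unfolding xs_def length_filter_map_sorted_list_of_set[OF fin] .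
  have inj: "inj_on (\<lambda>i. A $$ (i, J i)) R"
  proof (rule inj_onI)
    fix i i' assume *: "i \<in> R" "i' \<in> R" "A $$ (i, J i) = A $$ (i', J i')"
    then have "(i, J i) = (i', J i')"
      using R J by (intro inj_onD[OF dist[unfolded distinct_entries_def]]) (simp, blast+)
    then show "i = i'" by simp
  qed
  have "card {i \<in> R. A $$ (i, J i) = q} \<le> 1"
  proof (subst card_le_Suc0_iff_eq[folded One_nat_def])
    show "\<forall>x\<in>{i \<in> R. A $$ (i, J i) = q}. \<forall>y\<in>{i \<in> R. A $$ (i, J i) = q}. x = y"
      using inj by (auto dest: inj_onD)
  qed (use fin in auto)
  moreover have "survivors A R t J \<subseteq> {i \<in> R. A $$ (i, J i) < q} \<union> {i \<in> R. A $$ (i, J i) = q}"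
    by (auto simp: survivors_def round_threshold_def q_def N_def xs_def)
  then have "card (survivors A R t J) \<le>
      card ({i \<in> R. A $$ (i, J i) < q} \<union> {i \<in> R. A $$ (i, J i) = q})"
    using fin by (intro card_mono) auto
  then have "card (survivors A R t J) \<le> card {i \<in> R. A $$ (i, J i) < q} + card {i \<in> R. A $$ (i, J i) = q}"
    using card_Un_le order_trans by blast
  ultimately have "card (survivors A R t J) \<le> N"
    using less by linarith
  then show ?thesis unfolding N_def by linarith
qed

lemma prob_round_bad_le:
  fixes A :: "'a::linorder mat"
  defines "bad \<equiv> \<lambda>R t \<gamma> E. {J. (\<Sum>i\<in>survivors A R t J. row_cdf A i (round_threshold A R t J))
                \<le> 9/16 * real (card R) - 3/2 * E - \<gamma> * real (card R)}"
  assumes k: "dim_col A > 0" and fin: "finite R" and ne: "R \<noteq> {}"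
    and \<gamma>: "\<gamma> \<ge> 0" "\<gamma> * real (card R) \<le> E"
    and inv: "(\<Sum>i\<in>R. row_cdf A i t) \<ge> 3/4 * real (card R) - E"
  shows "measure_pmf.prob (Pi_pmf R 0 (\<lambda>_. random_position A)) (bad R t \<gamma> E)
         \<le> 2 * exp (- 2 * \<gamma>\<^sup>2 * real (card R))"
proof -
  txt \<open>The new threshold is random, but it is at least the fixed value \<open>x\<close> unless too many samples
    are at most \<open>Max W\<close>. This avoids a union bound over the possible thresholds, whose number is
    not bounded in terms of \<open>m\<close>.\<close>
  define n where "n = real (card R)"
  define P where "P = Pi_pmf R 0 (\<lambda>_. random_position A)"
  define \<mu> where "\<mu> = (\<lambda>v. \<Sum>i\<in>R. row_cdf A i v)"
  define V where "V = insert t ((\<lambda>(i, j). Fin (A $$ (i, j))) ` (R \<times> {..<dim_col A}))"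
  \<comment> \<open>By monotonicity of \<open>\<mu>\<close>, \<open>W\<close> is the lower part of
    the candidate values, and \<open>x\<close> is the first value above it.\<close>
  define W where "W = {v \<in> V. \<mu> v < 3/4 * n - E}"
  define x where "x = Min (V - W)"
  have n: "n > 0" using fin ne by (simp add: n_def card_gt_0_iff)
  have finV: "finite V" "finite W" using fin by (auto simp: V_def W_def)
  have tVW: "t \<in> V - W" using inv by (auto simp: V_def W_def \<mu>_def n_def)
  then have xVW: "x \<in> V - W" unfolding x_def using finV by (intro Min_in) auto
  have x_le: "x \<le> v" if "v \<in> V - W" for v
    unfolding x_def using finV that by (intro Min_le) auto
  have \<mu>x: "\<mu> x \<ge> 3/4 * n - E" using xVW by (auto simp: W_def)
  define ind where "ind = (\<lambda>v i j. indicator {j. Fin (A $$ (i, j)) \<le> v} j :: real)"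
  have E_ind: "measure_pmf.expectation (random_position A) (ind v i) = row_cdf A i v" for v i
    by (simp add: ind_def row_cdf_def)
  have sum_ind: "(\<Sum>i\<in>R. ind v i (J i)) = real (card {i \<in> R. Fin (A $$ (i, J i)) \<le> v})" for v J
  proof -
    have "(\<Sum>i\<in>R. ind v i (J i)) = (\<Sum>i\<in>{i \<in> R. Fin (A $$ (i, J i)) \<le> v}. 1)"
      using fin by (intro sum.mono_neutral_cong_right) (auto simp: ind_def)
    then show ?thesis by simp
  qed
  define B1 where "B1 = {J. W \<noteq> {} \<and> (\<Sum>i\<in>R. ind (Max W) i (J i)) \<ge> \<mu> (Max W) + \<gamma> * n}"
  \<comment> \<open>A row has weight \<open>row_cdf A i x\<close> and its sample is at most
    \<open>x\<close> with that same probability, so the mean of the weighted sum is the sum of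
    squares.\<close>
  define B2 where "B2 = {J. (\<Sum>i\<in>R. row_cdf A i x * ind x i (J i)) \<le> (\<Sum>i\<in>R. (row_cdf A i x)\<^sup>2) - \<gamma> * n}"
  have ex: "- 2 * (\<gamma> * n)\<^sup>2 / real (card R) = - 2 * \<gamma>\<^sup>2 * n"
    using n by (simp add: n_def power2_eq_square)
  have "measure_pmf.prob P B1 \<le> measure_pmf.prob P
      {J. (\<Sum>i\<in>R. ind (Max W) i (J i)) \<ge> (\<Sum>i\<in>R. measure_pmf.expectation (random_position A) (ind (Max W) i)) + \<gamma> * n}"
    by (intro measure_pmf.finite_measure_mono) (auto simp: B1_def E_ind \<mu>_def)
  also have "\<dots> \<le> exp (- 2 * (\<gamma> * n)\<^sup>2 / real (card R))"
    unfolding P_def using fin ne \<gamma> n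
    by (intro Hoeffding_Pi_pmf_ge) (auto simp: ind_def indicator_def)
  finally have p1: "measure_pmf.prob P B1 \<le> exp (- 2 * \<gamma>\<^sup>2 * n)" unfolding ex .
  have "measure_pmf.prob P B2 \<le> measure_pmf.prob P
      {J. (\<Sum>i\<in>R. row_cdf A i x * ind x i (J i)) \<le>
          (\<Sum>i\<in>R. measure_pmf.expectation (random_position A) (\<lambda>j. row_cdf A i x * ind x i j)) - \<gamma> * n}"
    by (intro measure_pmf.finite_measure_mono) (auto simp: B2_def E_ind power2_eq_square)
  also have "\<dots> \<le> exp (- 2 * (\<gamma> * n)\<^sup>2 / real (card R))"
    unfolding P_def using fin ne \<gamma> n
    by (intro Hoeffding_Pi_pmf_le) (auto simp: ind_def indicator_def)
  finally have p2: "measure_pmf.prob P B2 \<le> exp (- 2 * \<gamma>\<^sup>2 * n)" unfolding ex .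
  \<comment> \<open>Restricting to the support keeps the sampled positions inside the matrix, so
    that \<open>Fin q\<close> is one of the candidates in \<open>V\<close>.\<close>
  have "bad R t \<gamma> E \<inter> set_pmf P \<subseteq> B1 \<union> B2"
  proof (rule ccontr)
    assume "\<not> bad R t \<gamma> E \<inter> set_pmf P \<subseteq> B1 \<union> B2"
    then obtain J where J: "J \<in> bad R t \<gamma> E" "J \<in> set_pmf P" "J \<notin> B1" "J \<notin> B2" by blast
    have Jk: "J i < dim_col A" if "i \<in> R" for i
      using J(2) that fin k
      by (auto simp: P_def set_Pi_pmf PiE_dflt_def set_random_position)
    define N where "N = nat \<lceil>3/4 * real (card R)\<rceil>"
    define xs where "xs = map (\<lambda>i. A $$ (i, J i)) (sorted_list_of_set R)"
    define q where "q = nth_smallest N xs"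
    define t' where "t' = round_threshold A R t J"
    have t': "t' = min t (Fin q)" by (simp add: t'_def round_threshold_def q_def N_def xs_def)
    have N: "1 \<le> N" "N \<le> length xs"
      using quantile_index_bounds[OF fin ne] by (simp_all add: N_def xs_def)
    have "q \<in> set xs" unfolding q_def by (rule nth_smallest_in_set[OF N])
    then have qV: "Fin q \<in> V" using Jk fin by (force simp: xs_def V_def)
    have "N \<le> card {i \<in> R. A $$ (i, J i) \<le> q}"
      using nth_smallest_le_iff[OF N, of q]
      unfolding q_def[symmetric] unfolding xs_def length_filter_map_sorted_list_of_set[OF fin]
      by simp
    then have Nq: "3/4 * n \<le> real (card {i \<in> R. A $$ (i, J i) \<le> q})"
      unfolding N_def n_def by linarith
    \<comment> \<open>At least \<open>3/4 * n\<close> samples are at most \<open>q\<close>, but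
      outside \<open>B1\<close> fewer than \<open>3/4 * n - E + \<gamma> * n\<close> are at most
      \<open>Max W\<close>. Here \<open>\<gamma> * n \<le> E\<close> enters.\<close>
    have "Fin q \<notin> W"
    proof
      assume qW: "Fin q \<in> W"
      then have "Fin q \<le> Max W" using finV by simp
      then have "card {i \<in> R. A $$ (i, J i) \<le> q} \<le> card {i \<in> R. Fin (A $$ (i, J i)) \<le> Max W}"
        using fin by (intro card_mono) (auto intro: order_trans[of "Fin _" "Fin q"])
      moreover have "real (card {i \<in> R. Fin (A $$ (i, J i)) \<le> Max W}) < \<mu> (Max W) + \<gamma> * n"
        using J(3) qW by (auto simp: B1_def sum_ind)
      moreover have "Max W \<in> W" using finV qW by (intro Max_in) auto
      then have "\<mu> (Max W) < 3/4 * n - E" by (simp add: W_def)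
      ultimately show False using Nq \<gamma>(2) by (simp add: n_def)
    qed
    then have xt': "x \<le> t'" unfolding t' min_def using qV tVW by (auto intro: x_le)
    \<comment> \<open>The convexity step: the square of \<open>y\<close> lies above its tangent at
      \<open>3/4\<close>, which is \<open>3/2 * y - 9/16\<close>.\<close>
    have "9/16 * n - 3/2 * E - \<gamma> * n \<le> 3/2 * \<mu> x - 9/16 * n - \<gamma> * n"
      using \<mu>x by simp
    also have "3/2 * \<mu> x - 9/16 * n = (\<Sum>i\<in>R. 3/2 * row_cdf A i x - 9/16)"
      by (simp add: \<mu>_def n_def sum_subtractf sum_distrib_left)
    also have "\<dots> \<le> (\<Sum>i\<in>R. (row_cdf A i x)\<^sup>2)"
    proof (rule sum_mono)
      fix i
      have "0 \<le> (row_cdf A i x - 3/4)\<^sup>2" by simp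
      then show "3/2 * row_cdf A i x - 9/16 \<le> (row_cdf A i x)\<^sup>2"
        by (simp add: power2_eq_square algebra_simps)
    qed
    also have "(\<Sum>i\<in>R. (row_cdf A i x)\<^sup>2) - \<gamma> * n < (\<Sum>i\<in>R. row_cdf A i x * ind x i (J i))"
      using J(4) by (simp add: B2_def)
    also have "\<dots> = (\<Sum>i\<in>{i \<in> R. Fin (A $$ (i, J i)) \<le> x}. row_cdf A i x)"
      using fin by (intro sum.mono_neutral_cong_right) (auto simp: ind_def)
    \<comment> \<open>Passing from \<open>x\<close> to the larger \<open>t'\<close> raises each
      summand and then only adds surviving rows.\<close>
    also have "\<dots> \<le> (\<Sum>i\<in>{i \<in> R. Fin (A $$ (i, J i)) \<le> x}. row_cdf A i t')"
      using xt' by (intro sum_mono row_cdf_mono)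
    also have "\<dots> \<le> (\<Sum>i\<in>survivors A R t J. row_cdf A i t')"
      using fin xt' by (intro sum_mono2) (auto simp: survivors_def t'_def)
    finally show False using J(1) by (simp add: bad_def t'_def n_def)
  qed
  then have "measure_pmf.prob P (bad R t \<gamma> E \<inter> set_pmf P) \<le> measure_pmf.prob P (B1 \<union> B2)"
    by (intro measure_pmf.finite_measure_mono) auto
  also have "\<dots> \<le> measure_pmf.prob P B1 + measure_pmf.prob P B2"
    by (intro measure_Un_le) auto
  finally show ?thesis using p1 p2 by (simp add: measure_Int_set_pmf P_def n_def)
qed

section \<open>The invariant of phase 1\<close>

text \<open>In the invariant \<open>D\<close> is the error bound \<open>12 \<gamma> m\<^sup>3\<close> for \<open>\<Sum>F\<^sub>i(t)\<close>, to be divided by \<open>|R|\<^sup>2\<close>.\<close>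

definition phase1_inv :: "'a::linorder mat \<Rightarrow> real \<Rightarrow> real \<Rightarrow> nat set \<Rightarrow> 'a extended \<Rightarrow> bool" where
  "phase1_inv A D L R t \<longleftrightarrow>
     R \<subseteq> {..<dim_row A} \<and> L \<le> real (card R) \<and>
     (\<Sum>i\<in>R. row_cdf A i t) \<ge> 3/4 * real (card R) - D / (real (card R))\<^sup>2 \<and>
     (\<forall>i\<in>{..<dim_row A} - R. \<exists>j<dim_col A. t < Fin (A $$ (i, j)))"

text \<open>The right-hand side equals \<open>12 * \<gamma> * n * (M/n)^3\<close>, and
  \<open>M/n \<ge> 1\<close>. Thus the error term can absorb the fluctuation and the rounding of a
  round.\<close>

lemma error_term_ge:
  fixes n M \<gamma> D :: real
  assumes "\<gamma> > 0" "D = 12 * \<gamma> * M^3" "0 < n" "n \<le> M"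
  shows "12 * (\<gamma> * n) \<le> D / n\<^sup>2"
proof -
  have "12 * \<gamma> * n^3 \<le> D"
    using assms by (simp add: power_mono)
  then show ?thesis
    using assms(3) by (simp add: field_simps power3_eq_cube power2_eq_square)
qed

text \<open>The deterministic part of a round: \<open>n\<close> and \<open>n'\<close> are the
  numbers of rows before and after it, \<open>s\<close> is the new sum of \<open>row_cdf\<close>. As
  each summand is at most 1, a lower bound on \<open>s\<close> is also one on
  \<open>n'\<close>.\<close>

lemma phase1_round_arith:
  fixes n n' M \<gamma> X D s :: real
  assumes \<gamma>: "\<gamma> > 0" and D: "D = 12 * \<gamma> * M^3" and X: "X \<ge> 50" "\<gamma> * X \<ge> 1"
    and small: "3/2 * D / X^3 + \<gamma> \<le> 1/16"
    and n: "X < n" "n \<le> M" and n': "n' \<le> 3/4 * n + 1" and s: "s \<le> n'"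
    and sge: "9/16 * n - 3/2 * (D / n\<^sup>2) - \<gamma> * n < s"
  shows "X / 2 \<le> n'" "3/4 * n' - D / n'\<^sup>2 \<le> s" "n' < n"
proof -
  have pos: "n > 0" "M > 0" "D > 0" "X > 0" using assms by auto
  have E: "12 * (\<gamma> * n) \<le> D / n\<^sup>2"
    using \<gamma> D pos(1) n(2) by (rule error_term_ge)
  have "D / n^3 \<le> D / X^3"
    using pos n by (intro divide_left_mono power_mono mult_pos_pos) auto
  then have "3/2 * (D / n^3) + \<gamma> \<le> 1/16" using small by simp
  then have "(3/2 * (D / n^3) + \<gamma>) * n \<le> 1/16 * n"
    using pos by (intro mult_right_mono) auto
  also have "(3/2 * (D / n^3) + \<gamma>) * n = 3/2 * (D / n\<^sup>2) + \<gamma> * n"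
    using pos by (simp add: field_simps power3_eq_cube power2_eq_square)
  \<comment> \<open>The errors cost at most \<open>n/16\<close> of \<open>9/16 * n\<close>. Since
    \<open>s \<le> n'\<close>, the round keeps more than half of the rows.\<close>
  finally have "n / 2 < s" using sge by simp
  then show "X / 2 \<le> n'" and "n' < n" using s n X n' by linarith+
  have n'pos: "n' > 0" using \<open>n / 2 < s\<close> s pos by linarith
  \<comment> \<open>\<open>X \<ge> 50\<close> makes the rounding term 1 at most
    \<open>2/100 * n\<close>, and \<open>(77/100)^2 < 3/5\<close>.\<close>
  have "n' \<le> 77/100 * n" using n' n X by linarith
  then have "n'\<^sup>2 \<le> (77/100 * n)\<^sup>2" using n'pos by (intro power_mono) auto
  also have "\<dots> \<le> 3/5 * n\<^sup>2" by (simp add: power2_eq_square)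
  finally have "D / (3/5 * n\<^sup>2) \<le> D / n'\<^sup>2"
    using pos n'pos by (intro divide_left_mono) auto
  then have "5/3 * (D / n\<^sup>2) \<le> D / n'\<^sup>2" by simp
  moreover have "1 \<le> \<gamma> * n" using X n \<gamma> mult_left_mono[of X n \<gamma>] by linarith
  \<comment> \<open>The gain \<open>5/3 - 3/2 = 1/6\<close> of the old error term is at least
    \<open>2 * \<gamma> * n\<close> by \<open>E\<close>. It pays for the fluctuation
    \<open>\<gamma> * n\<close> and for the rounding \<open>3/4\<close>, which explains the factor
    12 in \<open>D\<close>.\<close>
  ultimately show "3/4 * n' - D / n'\<^sup>2 \<le> s" using E sge n' by argo
qed

text \<open>Every good round deletes a row, so at most \<open>card R\<close> rounds contribute a
  failure probability of at most \<open>\<eta>\<close> each. This crude count suffices because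
  \<open>\<eta>\<close> will be superpolynomially small. The level \<open>X/2\<close> occurs because
  the loop runs only above \<open>X\<close> and a good round keeps more than half of the
  rows.\<close>

lemma measure_phase1_inv_ge:
  fixes A :: "'a::linorder mat"
  defines "M \<equiv> real (dim_row A)"
  defines "X \<equiv> M powr (19/20)"
  assumes dist: "distinct_entries A" and k: "dim_col A > 0"
    and \<gamma>: "\<gamma> > 0" and D: "D = 12 * \<gamma> * M^3" and X: "X \<ge> 50" "\<gamma> * X \<ge> 1"
    and small: "3/2 * D / X^3 + \<gamma> \<le> 1/16"
    and \<eta>: "\<eta> = 2 * exp (- 2 * \<gamma>\<^sup>2 * X)"
    and inv: "phase1_inv A D (X/2) R t"
  shows "1 - real (card R) * \<eta> \<le>
    measure (measure_spmf (phase1 A R t)) {(R', t'). phase1_inv A D (X/2) R' t'}"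
  using inv
proof (induction "card R" arbitrary: R t rule: less_induct)
  case less
  let ?S = "{(R', t'). phase1_inv A D (X/2) R' t'}"
  have \<eta>0: "\<eta> \<ge> 0" by (simp add: \<eta>)
  show ?case
  proof (cases "card R > nat \<lfloor>X\<rfloor>")
    case False
    then have "phase1 A R t = return_spmf (R, t)"
      by (subst phase1_unfold) (simp add: X_def M_def)
    then show ?thesis using less.prems \<eta>0 by (simp add: measure_return_pmf measure_measure_spmf_conv_measure_pmf)
  next
    case True
    define P where "P = Pi_pmf R 0 (\<lambda>_. random_position A)"
    define n where "n = real (card R)"
    define G where "G = {J. (\<Sum>i\<in>survivors A R t J. row_cdf A i (round_threshold A R t J))
                > 9/16 * n - 3/2 * (D / n\<^sup>2) - \<gamma> * n}"
    have eq: "phase1 A R t = bind_spmf (spmf_of_pmf P) (\<lambda>J.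
          phase1 A (survivors A R t J) (round_threshold A R t J))"
      using True by (subst phase1_unfold) (simp add: X_def M_def P_def)
    have nX: "X < n" using True X unfolding n_def by linarith
    have R: "R \<subseteq> {..<dim_row A}" using less.prems by (simp add: phase1_inv_def)
    have fin: "finite R" using R finite_subset by blast
    have ne: "R \<noteq> {}" using True by auto
    have nM: "n \<le> M" unfolding n_def M_def using card_mono[OF _ R] by simp
    have \<gamma>n: "\<gamma> * n \<le> D / n\<^sup>2"
    proof -
      have "0 < n" using nX X by simp
      then have "0 < \<gamma> * n" using \<gamma> by simp
      then show ?thesis using error_term_ge[OF \<gamma> D \<open>0 < n\<close> nM] by linarith
    qed
    have "measure_pmf.prob P (- G) \<le> 2 * exp (- 2 * \<gamma>\<^sup>2 * n)"
      using prob_round_bad_le[OF k fin ne, of \<gamma> "D / n\<^sup>2" t] \<gamma> \<gamma>n less.prems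
      by (simp add: P_def G_def n_def phase1_inv_def Collect_neg_eq[symmetric] not_less)
    also have "\<dots> \<le> \<eta>"
      unfolding \<eta> using nX \<gamma> by (simp add: mult_left_mono)
    finally have "measure_pmf.prob P G \<ge> 1 - \<eta>"
      using measure_pmf.prob_compl[of G P] by (simp add: Compl_eq_Diff_UNIV)
    then have PG: "1 - \<eta> \<le> measure (measure_spmf (spmf_of_pmf P)) G" by simp
    define b where "b = 1 - (n - 1) * \<eta>"
    have rec: "b \<le> measure (measure_spmf (phase1 A (survivors A R t J) (round_threshold A R t J))) ?S"
      if J: "J \<in> set_spmf (spmf_of_pmf P)" "J \<in> G" for J
    proof -
      let ?R' = "survivors A R t J" and ?t' = "round_threshold A R t J"
      have Jk: "J i < dim_col A" if "i \<in> R" for i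
        using J(1) that fin k
        by (auto simp: P_def set_Pi_pmf PiE_dflt_def set_random_position)
      have sle: "(\<Sum>i\<in>?R'. row_cdf A i ?t') \<le> real (card ?R')"
        using sum_bounded_above[of ?R' "\<lambda>i. row_cdf A i ?t'" 1] by simp
      note ar = phase1_round_arith[OF \<gamma> D X small nX nM card_survivors_le[OF dist R ne Jk, folded n_def] sle
          J(2)[unfolded G_def mem_Collect_eq]]
      have lt: "card ?R' < card R" using ar(3) by (simp add: n_def)
      \<comment> \<open>A row deleted now is witnessed by its own sample, one deleted earlier by its
        old entry, as the threshold never increases.\<close>
      have del: "\<exists>j<dim_col A. ?t' < Fin (A $$ (i, j))" if i: "i < dim_row A" "i \<notin> ?R'" for i
      proof (cases "i \<in> R")
        case True
        then show ?thesis using i Jk by (auto simp: survivors_def not_le)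
      next
        case False
        then obtain j where "j < dim_col A" "t < Fin (A $$ (i, j))"
          using less.prems i by (auto simp: phase1_inv_def)
        then show ?thesis using round_threshold_le[of A R t J] by (meson le_less_trans)
      qed
      have "phase1_inv A D (X/2) ?R' ?t'"
        unfolding phase1_inv_def using ar(1,2) R del by (auto simp: survivors_def)
      from less.hyps[OF lt this]
      have "1 - real (card ?R') * \<eta> \<le> measure (measure_spmf (phase1 A ?R' ?t')) ?S" .
      moreover have "real (card ?R') * \<eta> \<le> (n - 1) * \<eta>"
        using lt \<eta>0 by (intro mult_right_mono) (auto simp: n_def)
      ultimately show ?thesis by (simp add: b_def)
    qed
    \<comment> \<open>\<open>measure_bind_spmf_ge\<close> needs \<open>0 \<le> b\<close>; for
      negative \<open>b\<close> the claimed bound is itself at most 0.\<close>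
    show ?thesis
    proof (cases "b \<ge> 0")
      case True
      have "0 \<le> (n - 1) * \<eta> * \<eta>" using \<eta>0 nX X by simp
      then have "1 - n * \<eta> \<le> (1 - \<eta>) * b" by (simp add: b_def algebra_simps)
      also have "\<dots> \<le> measure (measure_spmf (phase1 A R t)) ?S"
        unfolding eq by (rule measure_bind_spmf_ge[OF True PG rec])
      finally show ?thesis by (simp add: n_def)
    next
      case False
      then have "1 - n * \<eta> \<le> 0" using \<eta>0 by (simp add: b_def algebra_simps)
      then show ?thesis unfolding n_def by (meson measure_nonneg order_trans)
    qed
  qed
qed

section \<open>Phase 2\<close>

lemma Fin_nth_smallest_le_iff:
  assumes "1 \<le> n" "n \<le> length xs"
  shows "Fin (nth_smallest n xs) \<le> t \<longleftrightarrow> n \<le> length (filter (\<lambda>x. Fin x \<le> t) xs)"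
  using assms by (cases t) (auto simp: nth_smallest_le_iff)

lemma length_filter_map_upt:
  "length (filter P (map f [0..<s])) = card {l \<in> {..<s}. P (f l)}"
  using length_filter_map_sorted_list_of_set[of "{..<s}" P f]
  by (simp add: lessThan_atLeast0)

lemma sum_indicator_eq_card:
  assumes "finite S"
  shows "(\<Sum>i\<in>S. indicator T (g i)) = real (card {i \<in> S. g i \<in> T})"
proof -
  have "(\<Sum>i\<in>S. indicator T (g i) :: real) = (\<Sum>i\<in>{i \<in> S. g i \<in> T}. 1)"
    using assms by (intro sum.mono_neutral_cong_right) auto
  then show ?thesis by simp
qed

text \<open>All members of the set except the one with the largest entry count towards
  \<open>num_smaller\<close> of that entry, which is below \<open>h\<close>.\<close>

lemma card_num_smaller_less:
  fixes A :: "'a::linorder mat"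
  assumes dist: "distinct_entries A" and r: "r < dim_row A"
  shows "card {j. j < dim_col A \<and> num_smaller A r (A $$ (r, j)) < h} \<le> h"
proof -
  define T where "T = {j. j < dim_col A \<and> num_smaller A r (A $$ (r, j)) < h}"
  have finT: "finite T" by (simp add: T_def)
  have inj: "inj_on (\<lambda>j. A $$ (r, j)) T"
  proof (rule inj_onI)
    fix j j' assume "j \<in> T" "j' \<in> T" "A $$ (r, j) = A $$ (r, j')"
    then have "(r, j) = (r, j')"
      using r by (intro inj_onD[OF dist[unfolded distinct_entries_def]]) (auto simp: T_def)
    then show "j = j'" by simp
  qed
  have "card T \<le> h"
  proof (cases "T = {}")
    case False
    define y where "y = Max ((\<lambda>j. A $$ (r, j)) ` T)"
    have "y \<in> (\<lambda>j. A $$ (r, j)) ` T"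
      unfolding y_def using finT False by (intro Max_in) auto
    then obtain j where j: "j \<in> T" "y = A $$ (r, j)" by auto
    have "T - {j} \<subseteq> {j'. j' < dim_col A \<and> A $$ (r, j') < y}"
    proof
      fix j' assume j': "j' \<in> T - {j}"
      then have "A $$ (r, j') \<le> y" unfolding y_def using finT by (intro Max_ge) auto
      moreover have "A $$ (r, j') \<noteq> y" using inj j j' by (auto dest: inj_onD)
      ultimately show "j' \<in> {j'. j' < dim_col A \<and> A $$ (r, j') < y}"
        using j' by (auto simp: T_def)
    qed
    then have "card (T - {j}) \<le> num_smaller A r y"
      unfolding num_smaller_def by (intro card_mono) auto
    also have "\<dots> < h" using j by (simp add: T_def)
    finally show ?thesis using j finT by (simp add: card_Diff_singleton)
  qed simp
  then show ?thesis by (simp add: T_def)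
qed

lemma num_smaller_mono: "x \<le> y \<Longrightarrow> num_smaller A r x \<le> num_smaller A r y"
  unfolding num_smaller_def by (intro card_mono) (auto intro: less_le_trans)

lemma prob_Pi_pmf_component:
  assumes "finite I" "i \<in> I"
  shows "measure_pmf.prob (Pi_pmf I d p) {f. f i \<in> Z} = measure_pmf.prob (p i) Z"
proof -
  have "measure_pmf.prob (map_pmf (\<lambda>f. f i) (Pi_pmf I d p)) Z = measure_pmf.prob (p i) Z"
    using assms by (simp add: Pi_pmf_component)
  then show ?thesis by (simp add: vimage_def)
qed

text \<open>The parameter \<open>h\<close> covers both notions of pivot:
  \<open>3 * h \<le> k\<close> puts the entries of too low rank into the lowest third of a row,
  below the \<open>2/5\<close>-quantile, and \<open>k div 4 \<le> h\<close> makes the test of the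
  algorithm succeed. The \<open>m + 1\<close> error terms come from a union bound over
  \<open>r0\<close> and the rows of \<open>R\<close>.\<close>

lemma prob_phase2_ge:
  fixes A :: "'a::linorder mat"
  defines "m \<equiv> dim_row A" and "k \<equiv> dim_col A"
  defines "s \<equiv> nat \<lfloor>real m powr (1/20)\<rfloor>"
  assumes dist: "distinct_entries A" and k: "k > 0"
    and R: "R \<subseteq> {..<m}"
    and del: "\<And>i. i < m \<Longrightarrow> i \<notin> R \<Longrightarrow> \<exists>j<k. t < Fin (A $$ (i, j))"
    and r0: "r0 \<in> R" "row_cdf A r0 t \<ge> 1/2"
    and h: "3 * h \<le> k" "k div 4 \<le> h" and s: "s \<ge> 60"
  shows "1 - (real m + 1) * exp (- real s / 200) \<le> measure_pmf.prob (phase2 A R t)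
    {Returned (A $$ (i, j)) | i j. i < m \<and> j < k \<and> every_row_reaches A (A $$ (i, j)) \<and>
       h \<le> num_smaller A i (A $$ (i, j))}"
    (is "_ \<le> measure_pmf.prob _ ?S")
proof -
  define Q where "Q = Pi_pmf {..<s} 0 (\<lambda>_::nat. random_position A)"
  define P where "P = Pi_pmf R (\<lambda>_. 0) (\<lambda>_. Q)"
  define N where "N = nat \<lfloor>2/5 * real s\<rfloor>"
  define xs where "xs = (\<lambda>J r. map (\<lambda>l. A $$ (r, J r l)) [0..<s])"
  define q' where "q' = (\<lambda>J r. nth_smallest N (xs J r))"
  define p where "p = (\<lambda>J. Min (q' J ` R))"
  define out where "out = (\<lambda>J. if R = {} \<or> Fin (p J) > t \<or>
              (\<exists>r<m. \<exists>j<k. A $$ (r, j) = p J \<and> int (num_smaller A r (p J)) < \<lfloor>real k / 4\<rfloor>)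
           then Failed else Returned (p J))"
  have phase2: "phase2 A R t = map_pmf out P"
    unfolding phase2_def Let_def out_def p_def q'_def xs_def N_def P_def Q_def m_def k_def s_def ..
  have fin: "finite R" using R finite_subset by blast
  have N: "1 \<le> N" "N \<le> length (xs J r)" for J r
    using s unfolding N_def xs_def length_map length_upt by linarith+
  have N_ge: "real N \<ge> 2/5 * real s - 1" and N_le: "real N \<le> 2/5 * real s"
    unfolding N_def by linarith+
  define U where "U = {j. Fin (A $$ (r0, j)) \<le> t}"
  define T where "T = (\<lambda>r. {j. num_smaller A r (A $$ (r, j)) < h})"
  \<comment> \<open>At least half of row \<open>r0\<close> is at most \<open>t\<close>; outside
    \<open>Z0\<close> more than \<open>2/5 * s \<ge> N\<close> samples of this row are.\<close>
  define Z0 where "Z0 = {g :: nat \<Rightarrow> nat. (\<Sum>l<s. indicator U (g l)) \<le>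
      (\<Sum>l<s. measure_pmf.expectation (random_position A) (indicator U)) - real s / 10}"
  \<comment> \<open>A mean of at most \<open>s / 3\<close> plus \<open>s / 20\<close> is
    \<open>23/60 * s\<close>, which is at most \<open>2/5 * s - 1 \<le> N\<close> because
    \<open>s \<ge> 60\<close>. The deviation \<open>s / 20\<close> yields the exponent
    \<open>s / 200\<close>.\<close>
  define Z where "Z = (\<lambda>r. {g :: nat \<Rightarrow> nat. (\<Sum>l<s. indicator (T r) (g l)) \<ge>
      (\<Sum>l<s. measure_pmf.expectation (random_position A) (indicator (T r))) + real s / 20})"
  have spos: "{..<s} \<noteq> {}" "real s > 0" using s by (auto simp: lessThan_empty_iff)
  have "measure_pmf.prob Q Z0 \<le> exp (- 2 * (real s / 10)\<^sup>2 / card {..<s})"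
    unfolding Q_def Z0_def using spos
    by (intro Hoeffding_Pi_pmf_le) (auto simp: indicator_def)
  also have "\<dots> \<le> exp (- real s / 200)"
    using spos by (simp add: power2_eq_square)
  finally have Z0: "measure_pmf.prob P {J. J r0 \<in> Z0} \<le> exp (- real s / 200)"
    unfolding P_def using fin r0 by (simp add: prob_Pi_pmf_component)
  have Z: "measure_pmf.prob P {J. J r \<in> Z r} \<le> exp (- real s / 200)" if "r \<in> R" for r
  proof -
    have "measure_pmf.prob Q (Z r) \<le> exp (- 2 * (real s / 20)\<^sup>2 / card {..<s})"
      unfolding Q_def Z_def using spos
      by (intro Hoeffding_Pi_pmf_ge) (auto simp: indicator_def)
    also have "\<dots> = exp (- real s / 200)"
      using spos by (simp add: power2_eq_square)
    finally show ?thesis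
      unfolding P_def using fin that by (simp add: prob_Pi_pmf_component)
  qed
  have ET: "measure_pmf.expectation (random_position A) (indicator (T r)) \<le> (1/3 :: real)"
    if "r \<in> R" for r
  proof -
    have eq: "measure_pmf.expectation (random_position A) (indicator (T r) :: nat \<Rightarrow> real)
        = real (card ({..<k} \<inter> T r)) / real k"
      using k unfolding random_position_def k_def by (simp add: measure_pmf_of_set lessThan_empty_iff)
    have "card ({..<k} \<inter> T r) \<le> h"
      using card_num_smaller_less[OF dist, of r h] that R
      by (auto simp: T_def k_def m_def Int_def)
    then have "real (card ({..<k} \<inter> T r)) / real k \<le> real h / real k"
      by (intro divide_right_mono) auto
    also have "\<dots> \<le> 1/3" using h k by (simp add: field_simps)
    finally show ?thesis using eq by simp
  qed
  define B where "B = {J. J r0 \<in> Z0} \<union> (\<Union>r\<in>R. {J. J r \<in> Z r})"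
  have "- (out -` ?S) \<inter> set_pmf P \<subseteq> B"
  proof (rule ccontr)
    assume "\<not> - (out -` ?S) \<inter> set_pmf P \<subseteq> B"
    then obtain J where J: "out J \<notin> ?S" "J \<in> set_pmf P" "J r0 \<notin> Z0" "\<And>r. r \<in> R \<Longrightarrow> J r \<notin> Z r"
      unfolding B_def by blast
    have Jk: "J r l < k" if "r \<in> R" "l < s" for r l
      using J(2) that fin k unfolding P_def Q_def k_def
      by (auto simp: set_Pi_pmf PiE_dflt_def set_random_position)
    have q'_in: "\<exists>l<s. q' J r = A $$ (r, J r l)" for r
      using nth_smallest_in_set[OF N, of J r] by (auto simp: q'_def xs_def)
    have "q' J r0 \<in> q' J ` R" using r0 by simp
    then have p_in: "p J \<in> q' J ` R" and p_le: "p J \<le> q' J r" if "r \<in> R" for r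
      unfolding p_def using fin that by (auto intro!: Min_in)
    obtain r where r: "r \<in> R" "p J = q' J r" using p_in r0(1) by blast
    obtain l where l: "l < s" "p J = A $$ (r, J r l)" using q'_in[of r] r by auto
    have "real (card {l \<in> {..<s}. J r0 l \<in> U}) > real s * row_cdf A r0 t - real s / 10"
      using J(3) by (simp add: Z0_def sum_indicator_eq_card U_def row_cdf_def)
    moreover have "real s * row_cdf A r0 t \<ge> real s * (1/2)"
      using r0 by (intro mult_left_mono) auto
    ultimately have "N \<le> card {l \<in> {..<s}. J r0 l \<in> U}"
      using N_le by linarith
    then have "Fin (q' J r0) \<le> t"
      unfolding q'_def using Fin_nth_smallest_le_iff[OF N, of J r0 t]
      by (simp add: xs_def length_filter_map_upt U_def del: length_filter_map)
    then have pt: "Fin (p J) \<le> t"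
      using p_le[OF r0(1)] by (meson less_eq_extended.simps(1) order_trans)
    \<comment> \<open>Otherwise the at least \<open>N\<close> samples of row \<open>r\<close> that
      are at most \<open>p J\<close> would all lie in \<open>T r\<close>, which is excluded outside
      \<open>Z r\<close>.\<close>
    have ns: "h \<le> num_smaller A r (p J)"
    proof (rule ccontr)
      assume "\<not> h \<le> num_smaller A r (p J)"
      then have sub: "{l \<in> {..<s}. A $$ (r, J r l) \<le> p J} \<subseteq> {l \<in> {..<s}. J r l \<in> T r}"
        using num_smaller_mono[of _ "p J" A r] by (force simp: T_def)
      have "N \<le> card {l \<in> {..<s}. A $$ (r, J r l) \<le> p J}"
        using nth_smallest_le_iff[OF N, of J r "p J"] r(2)
        by (simp add: q'_def xs_def length_filter_map_upt del: length_filter_map)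
      also have "\<dots> \<le> card {l \<in> {..<s}. J r l \<in> T r}"
        using sub by (intro card_mono) auto
      finally have "real N \<le> real (card {l \<in> {..<s}. J r l \<in> T r})" by simp
      also have "\<dots> < real s * measure_pmf.expectation (random_position A) (indicator (T r)) + real s / 20"
        using J(4)[OF r(1)] by (simp add: Z_def sum_indicator_eq_card)
      also have "\<dots> \<le> real s * (1/3) + real s / 20"
        using ET[OF r(1)] by (intro add_right_mono mult_left_mono) auto
      finally show False using N_ge s by linarith
    qed
    have "every_row_reaches A (p J)"
      unfolding every_row_reaches_def
    proof (intro allI impI)
      fix i assume i: "i < dim_row A"
      show "\<exists>j<dim_col A. p J \<le> A $$ (i, j)"
      proof (cases "i \<in> R")
        case True
        obtain l' where "l' < s" "q' J i = A $$ (i, J i l')" using q'_in by blast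
        then show ?thesis using True p_le[of i] Jk[of i l'] by (auto simp: k_def)
      next
        case False
        then obtain j where "j < k" "t < Fin (A $$ (i, j))" using del i by (auto simp: m_def)
        moreover from this have "Fin (p J) < Fin (A $$ (i, j))" using pt by (meson le_less_trans)
        ultimately show ?thesis by (auto simp: k_def)
      qed
    qed
    moreover have "\<not> (\<exists>r'<m. \<exists>j<k. A $$ (r', j) = p J \<and> int (num_smaller A r' (p J)) < \<lfloor>real k / 4\<rfloor>)"
    proof
      assume "\<exists>r'<m. \<exists>j<k. A $$ (r', j) = p J \<and> int (num_smaller A r' (p J)) < \<lfloor>real k / 4\<rfloor>"
      then obtain r' j where r': "r' < m" "j < k" "A $$ (r', j) = p J"
        "int (num_smaller A r' (p J)) < \<lfloor>real k / 4\<rfloor>" by blast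
      \<comment> \<open>Distinct entries make the position of \<open>p J\<close> unique, so the test
        concerns row \<open>r\<close> only.\<close>
      have "(r', j) = (r, J r l)"
        using r' r R l Jk unfolding m_def k_def
        by (intro inj_onD[OF dist[unfolded distinct_entries_def]]) auto
      then have "h < k div 4"
        using r'(4) ns floor_divide_of_nat_eq[of k 4, where ?'a = real] by auto
      then show False using h by simp
    qed
    ultimately have "out J = Returned (A $$ (r, J r l))" "every_row_reaches A (A $$ (r, J r l))"
      "h \<le> num_smaller A r (A $$ (r, J r l))"
      using r0 pt l ns by (auto simp: out_def)
    then have "out J \<in> ?S" using r R Jk l by blast
    then show False using J(1) by simp
  qed
  then have "measure_pmf.prob P (- (out -` ?S) \<inter> set_pmf P) \<le> measure_pmf.prob P B"
    by (intro measure_pmf.finite_measure_mono) auto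
  also have "\<dots> \<le> measure_pmf.prob P {J. J r0 \<in> Z0} + measure_pmf.prob P (\<Union>r\<in>R. {J. J r \<in> Z r})"
    unfolding B_def by (intro measure_Un_le) auto
  also have "measure_pmf.prob P (\<Union>r\<in>R. {J. J r \<in> Z r}) \<le> (\<Sum>r\<in>R. measure_pmf.prob P {J. J r \<in> Z r})"
    using fin by (intro measure_pmf.finite_measure_subadditive_finite) auto
  also have "\<dots> \<le> real (card R) * exp (- real s / 200)"
    using Z by (intro sum_bounded_above) auto
  also have "\<dots> \<le> real m * exp (- real s / 200)"
    using card_mono[OF _ R] by (intro mult_right_mono) auto
  finally have "measure_pmf.prob P (- (out -` ?S)) \<le> (real m + 1) * exp (- real s / 200)"
    using Z0 by (simp add: measure_Int_set_pmf algebra_simps)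
  then have "1 - (real m + 1) * exp (- real s / 200) \<le> measure_pmf.prob P (out -` ?S)"
    using measure_pmf.prob_compl[of "out -` ?S" P] by (simp add: Compl_eq_Diff_UNIV)
  then show ?thesis unfolding phase2 by simp
qed

section \<open>The two phases combined\<close>

text \<open>The bound on \<open>D\<close> keeps the error of the average at most \<open>1/4\<close>,
  so \<open>row_cdf\<close> has average at least \<open>3/4 - 1/4\<close>, and some row is not below
  \<open>1/2\<close>.\<close>

lemma phase1_inv_imp_large_row:
  assumes inv: "phase1_inv A D L R t" and L: "L > 0" and D: "4 * D \<le> L^3"
  obtains r where "r \<in> R" "row_cdf A r t \<ge> 1/2"
proof -
  define n where "n = real (card R)"
  have n: "n \<ge> L" and sum: "(\<Sum>i\<in>R. row_cdf A i t) \<ge> 3/4 * n - D / n\<^sup>2"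
    using inv by (auto simp: phase1_inv_def n_def)
  have "L^3 \<le> n^3" using n L by (intro power_mono) auto
  then have "D / n\<^sup>2 \<le> n / 4"
    using n L D by (simp add: field_simps power3_eq_cube power2_eq_square)
  then have ge: "n / 2 \<le> (\<Sum>i\<in>R. row_cdf A i t)" using sum by linarith
  have "\<exists>r\<in>R. row_cdf A r t \<ge> 1/2"
  proof (rule ccontr)
    assume "\<not> ?thesis"
    moreover have "finite R" "R \<noteq> {}" using n L unfolding n_def by (auto intro: ccontr)
    ultimately have "(\<Sum>i\<in>R. row_cdf A i t) < (\<Sum>i\<in>R. 1/2)"
      by (intro sum_strict_mono) (auto simp: not_le)
    then show False using ge by (simp add: n_def)
  qed
  then show ?thesis using that by blast
qed

text \<open>\<open>P\<close> stands for either notion of pivot, reached through the rank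
  \<open>h\<close>. The numerical assumptions on \<open>m\<close> are left open here and hold for
  all large \<open>m\<close>.\<close>

lemma prob_find_horizontal_pivot_ge:
  fixes A :: "'a::linorder mat"
  defines "m \<equiv> real (dim_row A)" and "k \<equiv> dim_col A"
  defines "X \<equiv> m powr (19/20)" and "\<gamma> \<equiv> m powr (- (3/10))"
  defines "D \<equiv> 12 * \<gamma> * m^3"
  assumes dist: "distinct_entries A" and k: "k > 0"
    and h: "3 * h \<le> k" "k div 4 \<le> h"
    and P: "\<And>i j. i < dim_row A \<Longrightarrow> j < k \<Longrightarrow> every_row_reaches A (A $$ (i, j)) \<Longrightarrow>
         h \<le> num_smaller A i (A $$ (i, j)) \<Longrightarrow> P A i j"
    and m: "m \<ge> 1" and X: "X \<ge> 50" "\<gamma> * X \<ge> 1" and small: "3/2 * D / X^3 + \<gamma> \<le> 1/24"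
    and s: "m powr (1/20) \<ge> 60"
    and fail: "m * (2 * exp (- 2 * \<gamma>\<^sup>2 * X)) + (m + 1) * exp (- (m powr (1/20) - 1) / 200) \<le> \<delta>"
  shows "prob_returns P A \<ge> 1 - \<delta>"
proof -
  define \<eta> where "\<eta> = 2 * exp (- 2 * \<gamma>\<^sup>2 * X)"
  define \<theta> where "\<theta> = (m + 1) * exp (- real (nat \<lfloor>m powr (1/20)\<rfloor>) / 200)"
  let ?G = "{(R', t'). phase1_inv A D (X/2) R' t'}"
  let ?S = "{Returned (A $$ (i, j)) | i j. P A i j}"
  have \<gamma>: "\<gamma> > 0" using m by (simp add: \<gamma>_def)
  have D: "D > 0" using \<gamma> m by (simp add: D_def)
  have "m powr (19/20) \<le> m powr 1" using m by (intro powr_mono) auto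
  moreover have "0 \<le> D / m\<^sup>2" using D by simp
  then have "3/4 * m - D / m\<^sup>2 \<le> m" using m by linarith
  ultimately have inv0: "phase1_inv A D (X/2) {..<dim_row A} Pinf"
    using m by (auto simp: phase1_inv_def X_def m_def)
  have D_eq: "D = 12 * \<gamma> * real (dim_row A)^3" by (simp add: D_def m_def)
  have phase1: "1 - m * \<eta> \<le> measure (measure_spmf (phase1 A {..<dim_row A} Pinf)) ?G"
    using measure_phase1_inv_ge[OF dist k[unfolded k_def] \<gamma> D_eq X[unfolded X_def m_def] _ refl
      inv0[unfolded X_def m_def]]
    small by (simp add: X_def m_def \<eta>_def)
  have phase2: "1 - \<theta> \<le> measure (measure_spmf ((\<lambda>(R, t). spmf_of_pmf (phase2 A R t)) Rt)) ?S"
    if "Rt \<in> ?G" for Rt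
  proof -
    obtain R t where Rt: "Rt = (R, t)" by fastforce
    have inv: "phase1_inv A D (X/2) R t" using that Rt by simp
    \<comment> \<open>The \<open>1/24\<close>, sharper than the \<open>1/16\<close> of phase 1,
      gives \<open>4 * D \<le> X^3 / 9\<close>, where \<open>X^3 / 8\<close> is allowed.\<close>
    have "3/2 * D / X^3 \<le> 1/24" using small \<gamma> by linarith
    then have "4 * D \<le> (X/2)^3" using X D by (simp add: field_simps)
    then obtain r where r: "r \<in> R" "row_cdf A r t \<ge> 1/2"
      using phase1_inv_imp_large_row[OF inv] X by auto
    have "1 - \<theta> \<le> measure_pmf.prob (phase2 A R t)
      {Returned (A $$ (i, j)) | i j. i < dim_row A \<and> j < dim_col A \<and>
         every_row_reaches A (A $$ (i, j)) \<and> h \<le> num_smaller A i (A $$ (i, j))}"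
      unfolding \<theta>_def m_def
      by (rule prob_phase2_ge[OF dist]) (use inv r h k s in \<open>auto simp: phase1_inv_def k_def m_def le_nat_floor\<close>)
    also have "\<dots> \<le> measure_pmf.prob (phase2 A R t) ?S"
      using P by (intro measure_pmf.finite_measure_mono) (auto simp: k_def)
    finally show ?thesis by (simp add: Rt)
  qed
  have \<theta>: "\<theta> \<le> (m + 1) * exp (- (m powr (1/20) - 1) / 200)"
  proof -
    have "m powr (1/20) - 1 \<le> real (nat \<lfloor>m powr (1/20)\<rfloor>)" by linarith
    then have "- real (nat \<lfloor>m powr (1/20)\<rfloor>) / 200 \<le> - (m powr (1/20) - 1) / 200" by argo
    then show ?thesis unfolding \<theta>_def using m by (intro mult_left_mono) (simp_all only: exp_le_cancel_iff)
  qed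
  have nn: "0 \<le> m * \<eta>" "0 \<le> \<theta>" using m by (auto simp: \<eta>_def \<theta>_def)
  have le: "m * \<eta> + \<theta> \<le> \<delta>" using fail \<theta> by (simp add: \<eta>_def)
  \<comment> \<open>If \<open>\<theta> > 1\<close>, then \<open>\<delta> > 1\<close> and the bound
    is trivial.\<close>
  show ?thesis
  proof (cases "\<theta> \<le> 1")
    case True
    have "1 - \<delta> \<le> (1 - m * \<eta>) * (1 - \<theta>)"
      using le mult_nonneg_nonneg[OF nn] by (simp add: algebra_simps)
    also have "\<dots> \<le> prob_returns P A"
      unfolding prob_returns_def find_horizontal_pivot_def
      using True by (intro measure_bind_spmf_ge[OF _ phase1 phase2]) auto
    finally show ?thesis .
  next
    case False
    then have "1 - \<delta> \<le> 0" using le nn by linarith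
    then show ?thesis unfolding prob_returns_def by (meson measure_nonneg order_trans)
  qed
qed

section \<open>Asymptotics of the parameters\<close>

theorem theorem13:
  shows "\<exists>c::real. c > 0 \<and>
    (\<forall>\<^sub>F m in sequentially. \<forall>k>0. \<forall>A :: 'a::linorder mat.
       A \<in> carrier_mat m k \<longrightarrow> distinct_entries A \<longrightarrow>
         (k \<notin> {1, 2, 5} \<longrightarrow>
            prob_returns horizontal_pivot A \<ge> 1 - exp (- (c * real m powr (1/20)))) \<and>
         prob_returns horizontal_pivot_floor A \<ge> 1 - exp (- (c * real m powr (1/20))))"
proof (intro exI conjI)
  \<comment> \<open>Half of the \<open>1/200\<close> from phase 2, which leaves room for the factor
    \<open>m + 1\<close> and the error of phase 1.\<close>
  show "(1/400 :: real) > 0" by simp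
  have e1: "\<forall>\<^sub>F m in sequentially. real m \<ge> 1 \<and> real m powr (19/20) \<ge> 50 \<and> real m powr (1/20) \<ge> 60"
    by (intro eventually_conj; real_asymp)
  have e2: "\<forall>\<^sub>F m in sequentially. real m powr (- (3/10)) * real m powr (19/20) \<ge> 1"
    by real_asymp
  \<comment> \<open>\<open>D\<close> has exponent \<open>27/10\<close> and \<open>X^3\<close> has
    \<open>57/20\<close>, so the quotient is of order \<open>m powr (- (3/20))\<close>.\<close>
  have e3: "\<forall>\<^sub>F m in sequentially.
    3/2 * (12 * real m powr (- (3/10)) * real m^3) / (real m powr (19/20))^3 + real m powr (- (3/10)) \<le> 1/24"
    by real_asymp
  \<comment> \<open>The exponent of phase 1 is \<open>- 2 * m powr (7/20)\<close>, so its term is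
    negligible against the one of phase 2.\<close>
  have e4: "\<forall>\<^sub>F m in sequentially.
    real m * (2 * exp (- 2 * (real m powr (- (3/10)))\<^sup>2 * real m powr (19/20)))
      + (real m + 1) * exp (- (real m powr (1/20) - 1) / 200) \<le> exp (- (1/400 * real m powr (1/20)))"
    by real_asymp
  show "\<forall>\<^sub>F m in sequentially. \<forall>k>0. \<forall>A :: 'a mat.
       A \<in> carrier_mat m k \<longrightarrow> distinct_entries A \<longrightarrow>
         (k \<notin> {1, 2, 5} \<longrightarrow>
            prob_returns horizontal_pivot A \<ge> 1 - exp (- (1/400 * real m powr (1/20)))) \<and>
         prob_returns horizontal_pivot_floor A \<ge> 1 - exp (- (1/400 * real m powr (1/20)))"
    using e1 e2 e3 e4
  proof (eventually_elim, intro allI impI conjI)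
    fix m k :: nat and A :: "'a mat"
    assume m: "real m \<ge> 1 \<and> real m powr (19/20) \<ge> 50 \<and> real m powr (1/20) \<ge> 60"
      "real m powr (- (3/10)) * real m powr (19/20) \<ge> 1"
      "3/2 * (12 * real m powr (- (3/10)) * real m^3) / (real m powr (19/20))^3 + real m powr (- (3/10)) \<le> 1/24"
      "real m * (2 * exp (- 2 * (real m powr (- (3/10)))\<^sup>2 * real m powr (19/20)))
      + (real m + 1) * exp (- (real m powr (1/20) - 1) / 200) \<le> exp (- (1/400 * real m powr (1/20)))"
      and k: "k > 0" and A: "A \<in> carrier_mat m k" and dist: "distinct_entries A"
    have dims: "dim_row A = m" "dim_col A = k" using A by auto
    note general = prob_find_horizontal_pivot_ge[OF dist, unfolded dims, OF k _ _ _ _ _ m(2,3) _ m(4)]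
    show "prob_returns horizontal_pivot A \<ge> 1 - exp (- (1/400 * real m powr (1/20)))"
      if k': "k \<notin> {1, 2, 5}"
    proof (rule general)
      \<comment> \<open>\<open>(k + 3) div 4\<close> is \<open>k/4\<close> rounded up; among
        positive \<open>k\<close> the inequality fails for 1, 2 and 5 only.\<close>
      show "3 * ((k + 3) div 4) \<le> k"
      proof (cases "k \<ge> 9")
        case False
        then have "k \<in> {3, 4, 6, 7, 8}" using k k' by auto
        then show ?thesis by auto
      qed linarith
    qed (use m(1) in \<open>auto simp: horizontal_pivot_def dims\<close>)
    show "prob_returns horizontal_pivot_floor A \<ge> 1 - exp (- (1/400 * real m powr (1/20)))"
      by (rule general[where h = "k div 4"])
         (use m(1) floor_divide_of_nat_eq[of k 4, where ?'a = real] in \<open>auto simp: horizontal_pivot_floor_def dims\<close>)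
  qed
qed

end
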